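(* In any interactive temporal assumption model $\mathcal{W}$, the formula $$\neg\Box\big[B^{ab}A^{ba}(\mathbf{U}^a\wedge\bigcirc\Box \mathbf{D})\big]$$ is valid.
   Context: A belief model is a two-sorted structure $(U^a,U^b,P^a,P^b)$ with nonempty $U^a,U^b$, $P^a$ a proper subset of $U^a\times U^b$, $P^b$ a proper subset of $U^b\times U^a$, both serial. An interactive temporal assumption model (iTAL-model) is a Kripke structure $\mathcal{W}=(W,\mathbb{N},\{P_n:n\in\mathbb{N}\},U^a,U^b,V)$ where $W$ is a nonempty set, each $P_n\subseteq W\times W$, $U^a,U^b$ are disjoint with $U^a\cup U^b=W$, and for each $n$, $(U^a,U^b,P_n^a,P_n^b)$ is a belief model with $P_n^a=P_n\cap(U^a\times U^b)$, $P_n^b=P_n\cap(U^b\times U^a)$; $V$ maps each propositional letter to a subset of $\mathbb{N}\times W$. Formulas are built from propositional letters with $\neg,\wedge$, the temporal operators $\bigcirc$ ("next") and $\Box$ ("always"), and epistemic operators $B^{ij}$ (belief of player $i$ about $j$) and $A^{ij}$ (assumption of $i$ about $j$), $i,j\in\{a,b\}$. Satisfaction at a moment $n$ and world $w$: $(n,w)\Vdash p$ iff $(n,w)\in V(p)$; usual clauses for $\neg,\wedge$; $(n,w)\Vdash\bigcirc\varphi$ iff $(n+1,w)\Vdash\varphi$; $(n,w)\Vdash\Box\varphi$ iff $(m,w)\Vdash\varphi$ for all $m\ge n$; $(n,w)\Vdash B^{ij}\varphi$ iff $(n,w)\Vdash\mathbf{U}^i$ and for all $z$, $(P_n(w,z)\wedge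 (n,z)\Vdash\mathbf{U}^j)\to (n,z)\Vdash\varphi$; $(n,w)\Vdash A^{ij}\varphi$ iff $(n,w)\Vdash\mathbf{U}^i$ and for all $z$, $(P_n(w,z)\wedge (n,z)\Vdash\mathbf{U}^j)\leftrightarrow (n,z)\Vdash\varphi$. Here $\mathbf{U}^a,\mathbf{U}^b$ are propositions true at worlds of $U^a$, resp. $U^b$. $\mathbf{D}$ is a propositional symbol with $V(\mathbf{D})=\{(n,x): \forall y\in W\,[P_n(x,y)\to\neg P_n(y,x)]\}$ (formal counterpart of "Ann believes that Bob's assumption is wrong"). A formula is valid in $\mathcal{W}$ if true at all states.
   Formalization: V(D) is defined with P_n^a ∪ P_n^b in place of P_n; with arbitrary P_n ⊆ W×W the claim fails, e.g. U^a={0,1}, U^b={2,3}, P_n={(0,0),(0,2),(2,1),(1,3),(3,0)} at world 0. The two agree when P_n relates only worlds of different sorts. *)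

theory Defs
  imports Main
begin

definition serial_on :: "'u set \<Rightarrow> 'v set \<Rightarrow> ('u \<times> 'v) set \<Rightarrow> bool" where
  "serial_on A B R \<longleftrightarrow> (\<forall>x\<in>A. \<exists>y\<in>B. (x, y) \<in> R)"

definition belief_model ::
    "'u set \<Rightarrow> 'v set \<Rightarrow> ('u \<times> 'v) set \<Rightarrow> ('v \<times> 'u) set \<Rightarrow> bool" where
  "belief_model Ua Ub Pa Pb \<longleftrightarrow>
     Ua \<noteq> {} \<and> Ub \<noteq> {} \<and>
     Pa \<subset> Ua \<times> Ub \<and> Pb \<subset> Ub \<times> Ua \<and>
     serial_on Ua Ub Pa \<and> serial_on Ub Ua Pb"

datatype player = Ann | Bob

text \<open>The propositional letters include the distinguished symbols for the two sorts and the
  diagonal symbol \<open>DD\<close>; \<open>'p\<close> supplies the remaining letters.\<close>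

datatype 'p letter = UU player | DD | Letter 'p

datatype 'p fm =
    Prop "'p letter"
  | Neg "'p fm"
  | Conj "'p fm" "'p fm"
  | Next "'p fm"
  | Always "'p fm"
  | Bel player player "'p fm"
  | Asm player player "'p fm"

record ('w, 'p) kripke =
  worlds :: "'w set"
  poss :: "nat \<Rightarrow> ('w \<times> 'w) set"
  sort_of :: "player \<Rightarrow> 'w set"
  val :: "'p letter \<Rightarrow> (nat \<times> 'w) set"

definition poss_between ::
    "('w, 'p) kripke \<Rightarrow> nat \<Rightarrow> player \<Rightarrow> player \<Rightarrow> ('w \<times> 'w) set" where
  "poss_between M n i j = poss M n \<inter> (sort_of M i \<times> sort_of M j)"

definition belief_rel :: "('w, 'p) kripke \<Rightarrow> nat \<Rightarrow> ('w \<times> 'w) set" where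
  "belief_rel M n = poss_between M n Ann Bob \<union> poss_between M n Bob Ann"

definition ital_structure :: "('w, 'p) kripke \<Rightarrow> bool" where
  "ital_structure M \<longleftrightarrow>
     worlds M \<noteq> {} \<and>
     (\<forall>n. poss M n \<subseteq> worlds M \<times> worlds M) \<and>
     sort_of M Ann \<inter> sort_of M Bob = {} \<and>
     sort_of M Ann \<union> sort_of M Bob = worlds M \<and>
     (\<forall>n. belief_model (sort_of M Ann) (sort_of M Bob)
       (poss_between M n Ann Bob) (poss_between M n Bob Ann)) \<and>
     (\<forall>p. val M p \<subseteq> UNIV \<times> worlds M) \<and>
     (\<forall>i. val M (UU i) = UNIV \<times> sort_of M i)"

definition diagonal :: "'w set \<Rightarrow> (nat \<Rightarrow> ('w \<times> 'w) set) \<Rightarrow> (nat \<times> 'w) set" where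
  "diagonal W R = {(n, x). x \<in> W \<and> (\<forall>y\<in>W. (x, y) \<in> R n \<longrightarrow> (y, x) \<notin> R n)}"

text \<open>The relation in the diagonal symbol is that of the underlying belief models: \<open>DD\<close> speaks of
  one player's belief about the other player's assumption. If \<open>poss M n\<close> relates only worlds of
  different sorts, \<open>belief_rel M n\<close> is \<open>poss M n\<close> itself (\<open>diagonal_poss\<close> below). If
  \<open>poss M n\<close> also has pairs inside one sort, these must not enter the diagonal: otherwise
  the formula \<open>\<not>\<box>B\<^sup>a\<^sup>bA\<^sup>b\<^sup>a(U\<^sup>a \<and> \<circle>\<box>D)\<close> is refutable
  (\<open>diagonal_poss_refutable\<close> below).\<close>

definition ital_model :: "('w, 'p) kripke \<Rightarrow> bool" where
  "ital_model M \<longleftrightarrow> ital_structure M \<and> val M DD = diagonal (worlds M) (belief_rel M)"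

primrec sat :: "('w, 'p) kripke \<Rightarrow> nat \<Rightarrow> 'w \<Rightarrow> 'p fm \<Rightarrow> bool" where
  "sat M n w (Prop p) \<longleftrightarrow> (n, w) \<in> val M p"
| "sat M n w (Neg \<phi>) \<longleftrightarrow> \<not> sat M n w \<phi>"
| "sat M n w (Conj \<phi> \<psi>) \<longleftrightarrow> sat M n w \<phi> \<and> sat M n w \<psi>"
| "sat M n w (Next \<phi>) \<longleftrightarrow> sat M (n + 1) w \<phi>"
| "sat M n w (Always \<phi>) \<longleftrightarrow> (\<forall>m\<ge>n. sat M m w \<phi>)"
| "sat M n w (Bel i j \<phi>) \<longleftrightarrow>
     (n, w) \<in> val M (UU i) \<and>
     (\<forall>z\<in>worlds M. (w, z) \<in> poss M n \<and> (n, z) \<in> val M (UU j) \<longrightarrow> sat M n z \<phi>)"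
| "sat M n w (Asm i j \<phi>) \<longleftrightarrow>
     (n, w) \<in> val M (UU i) \<and>
     (\<forall>z\<in>worlds M. (w, z) \<in> poss M n \<and> (n, z) \<in> val M (UU j) \<longleftrightarrow> sat M n z \<phi>)"

definition valid_in :: "('w, 'p) kripke \<Rightarrow> 'p fm \<Rightarrow> bool" where
  "valid_in M \<phi> \<longleftrightarrow> (\<forall>n. \<forall>w\<in>worlds M. sat M n w \<phi>)"

lemma diagonal_poss:
  assumes "\<And>n. poss M n \<subseteq> sort_of M Ann \<times> sort_of M Bob \<union> sort_of M Bob \<times> sort_of M Ann"
  shows "diagonal (worlds M) (belief_rel M) = diagonal (worlds M) (poss M)"
proof -
  have "belief_rel M = poss M"
    using assms by (fastforce simp: belief_rel_def poss_between_def)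
  then show ?thesis by simp
qed

lemma diagonal_poss_refutable:
  "\<exists>M :: (nat, 'p) kripke. ital_structure M \<and> val M DD = diagonal (worlds M) (poss M) \<and>
     \<not> valid_in M (Neg (Always (Bel Ann Bob (Asm Bob Ann (Conj (Prop (UU Ann)) (Next (Always (Prop DD))))))))"
proof -
  define S :: "player \<Rightarrow> nat set" where
    "S i = (case i of Ann \<Rightarrow> {0, 1} | Bob \<Rightarrow> {2, 3})" for i
  define W :: "nat set" where "W = {0, 1, 2, 3}"
  define R :: "nat \<Rightarrow> (nat \<times> nat) set" where
    "R n = {(0, 0), (0, 2), (2, 1), (1, 3), (3, 0)}" for n
  define V :: "'p letter \<Rightarrow> (nat \<times> nat) set" where
    "V p = (case p of UU i \<Rightarrow> UNIV \<times> S i | DD \<Rightarrow> diagonal W R | Letter q \<Rightarrow> {})" for p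
  define M :: "(nat, 'p) kripke" where
    "M = \<lparr>worlds = W, poss = R, sort_of = S, val = V\<rparr>"
  have sel: "worlds M = W" "poss M = R" "sort_of M = S" "val M = V"
    by (simp_all add: M_def)
  have S: "S Ann = {0, 1}" "S Bob = {2, 3}" by (simp_all add: S_def)
  have PB: "poss_between M n Ann Bob = {(0, 2), (1, 3)}"
    "poss_between M n Bob Ann = {(2, 1), (3, 0)}" for n
    by (auto simp: poss_between_def sel S R_def)
  have BM: "belief_model (S Ann) (S Bob) {(0, 2), (1, 3)} {(2, 1), (3, 0)}"
  proof -
    have "(0, 3) \<in> S Ann \<times> S Bob - {(0, 2), (1, 3)}"
      "(2, 0) \<in> S Bob \<times> S Ann - {(2, 1), (3, 0)}"
      by (simp_all add: S)
    then have "{(0, 2), (1, 3)} \<noteq> S Ann \<times> S Bob" "{(2, 1), (3, 0)} \<noteq> S Bob \<times> S Ann"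
      by blast+
    then show ?thesis
      by (simp add: belief_model_def serial_on_def psubset_eq) (simp add: S)
  qed
  have Vs: "V p \<subseteq> UNIV \<times> W" for p
  proof (cases p)
    case (UU i)
    then show ?thesis by (cases i) (auto simp: V_def S_def W_def)
  qed (auto simp: V_def diagonal_def)
  have "R n \<subseteq> W \<times> W" for n by (simp add: R_def W_def)
  moreover have "W \<noteq> {}" "S Ann \<inter> S Bob = {}" "S Ann \<union> S Bob = W"
    by (auto simp: S W_def)
  moreover have "V (UU i) = UNIV \<times> S i" for i by (simp add: V_def)
  ultimately have st: "ital_structure M"
    unfolding ital_structure_def PB sel using BM Vs by blast
  have dg: "V DD = UNIV \<times> {1, 2, 3}"
    by (auto simp: V_def diagonal_def W_def R_def)
  have "sat M n z (Asm Bob Ann (Conj (Prop (UU Ann)) (Next (Always (Prop DD)))))"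
    if "z = 2" for n z
    using that by (auto simp: sel dg) (auto simp: V_def W_def R_def S)
  then have "sat M n 0 (Bel Ann Bob (Asm Bob Ann (Conj (Prop (UU Ann)) (Next (Always (Prop DD))))))"
    for n
    by (auto simp: sel V_def R_def S simp del: sat.simps(7))
  then have "\<not> sat M 0 0 (Neg (Always (Bel Ann Bob (Asm Bob Ann
      (Conj (Prop (UU Ann)) (Next (Always (Prop DD))))))))"
    unfolding sat.simps(2,5) by blast
  moreover have "0 \<in> worlds M" by (simp add: sel W_def)
  moreover have "val M DD = diagonal (worlds M) (poss M)" by (simp add: sel V_def)
  ultimately show ?thesis using st unfolding valid_in_def by blast
qed

end

theory Submission
  imports Defs
begin

text \<open>Suppose Ann's world \<open>w\<close> satisfies the boxed formula from moment \<open>n\<close> on, and let \<open>E m\<close> be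
  the set of Ann's worlds that are diagonal at all moments after \<open>m\<close>. For \<open>m \<ge> n\<close>, every world
  \<open>z\<close> that \<open>w\<close> considers possible at \<open>m\<close> sees exactly \<open>E m\<close>. If \<open>w \<in> E m\<close>, then also
  \<open>w \<in> E (m + 1)\<close>, so some \<open>z\<close> seen by \<open>w\<close> at \<open>m + 1\<close> sees \<open>w\<close> back, although \<open>w\<close> is
  diagonal at \<open>m + 1\<close>. Hence \<open>w \<notin> E n\<close>, so \<open>w\<close> fails to be diagonal at some \<open>k > n\<close>; the
  world witnessing this is seen by \<open>w\<close> and sees \<open>w\<close> at \<open>k\<close>, which puts \<open>w\<close> into \<open>E k\<close>.\<close>

theorem theorem2:
  fixes M :: "('w, 'p) kripke"
  assumes "ital_model M"
  shows "valid_in M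
    (Neg (Always (Bel Ann Bob (Asm Bob Ann (Conj (Prop (UU Ann)) (Next (Always (Prop DD))))))))"
  unfolding valid_in_def sat.simps(2)
proof (intro allI ballI notI)
  fix n w
  assume w: "w \<in> worlds M"
    and always: "sat M n w
      (Always (Bel Ann Bob (Asm Bob Ann (Conj (Prop (UU Ann)) (Next (Always (Prop DD)))))))"
  have ital: "ital_structure M" and DD: "val M DD = diagonal (worlds M) (belief_rel M)"
    using assms by (simp_all add: ital_model_def)
  have UU: "val M (UU i) = UNIV \<times> sort_of M i" for i
    using ital by (simp add: ital_structure_def)
  have sorts: "sort_of M Ann \<inter> sort_of M Bob = {}" "sort_of M Ann \<union> sort_of M Bob = worlds M"
    using ital by (simp_all add: ital_structure_def)
  have serial: "serial_on (sort_of M Ann) (sort_of M Bob) (poss_between M m Ann Bob)" for m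
    using ital by (simp add: ital_structure_def belief_model_def)
  have wAnn: "w \<in> sort_of M Ann"
    using always by (auto simp: UU)
  \<comment> \<open>The bound \<open>k>m\<close> is strict because \<open>Next\<close> makes the
    inner \<open>Always\<close> start at \<open>Suc m\<close>.\<close>
  define E where "E m = {x \<in> sort_of M Ann. \<forall>k>m. (k, x) \<in> val M DD}" for m
  have sees_E: "(z, w) \<in> poss M m \<longleftrightarrow> w \<in> E m"
    if "m \<ge> n" "z \<in> sort_of M Bob" "(w, z) \<in> poss M m" for m z
  proof -
    have "sat M m z (Asm Bob Ann (Conj (Prop (UU Ann)) (Next (Always (Prop DD)))))"
      using always that sorts(2) unfolding sat.simps(5,6) by (auto simp: UU simp del: sat.simps)
    \<comment> \<open>The biconditional in \<open>Asm\<close> at \<open>z\<close> is instantiated at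
      \<open>w\<close> itself, the self-reference behind the paradox.\<close>
    then show ?thesis
      using w wAnn by (simp add: UU E_def Suc_le_eq) blast
  qed
  have not_E: "w \<notin> E m" if "m \<ge> n" for m
  proof
    assume "w \<in> E m"
    then have E: "w \<in> E (Suc m)" and D: "(Suc m, w) \<in> val M DD"
      by (auto simp: E_def)
    obtain z where z: "z \<in> sort_of M Bob" "(w, z) \<in> poss M (Suc m)"
      using serial[of "Suc m"] wAnn by (auto simp: serial_on_def poss_between_def)
    then have "(z, w) \<in> poss M (Suc m)"
      using sees_E[of "Suc m" z] E that by simp
    then show False
      using D z wAnn sorts(2) unfolding DD
      by (auto simp: diagonal_def belief_rel_def poss_between_def)
  qed
  obtain k where k: "k > n" "(k, w) \<notin> val M DD"
    using not_E[of n] wAnn by (auto simp: E_def)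
  \<comment> \<open>\<open>belief_rel\<close> only links worlds of different sorts, so the witness
    \<open>y\<close> against diagonality is Bob's, as \<open>sees_E\<close> requires.\<close>
  then obtain y where "y \<in> sort_of M Bob" "(w, y) \<in> poss M k" "(y, w) \<in> poss M k"
    using w wAnn sorts unfolding DD
    by (auto simp: diagonal_def belief_rel_def poss_between_def)
  then show False
    using sees_E[of k y] not_E[of k] k by simp
qed

end
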